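(* (Monotonicity property.) Consider a finite connected dissipative flow network $\mathcal{G}=(\mathcal{V},\mathcal{E})$ with dissipation functions $f_{ij}$, where the parameters $b_{ij}$, $(i,j)\in\mathcal{E}$, and the potential $\pi_0$ of a node $0\in\mathcal{V}$ are fixed. Let $q^{(1)}=(q^{(1)}_i)_{i\in\mathcal{V}\setminus\{0\}}$ and $q^{(2)}=(q^{(2)}_i)_{i\in\mathcal{V}\setminus\{0\}}$ be two sets of injections, the injection at node $0$ being determined in each case by total balance, $q^{(k)}_0=-\sum_{i\in\mathcal{V}\setminus\{0\}}q_i^{(k)}$, $k=1,2$. For $k=1,2$ let $\pi^{(k)}=(\pi^{(k)}_i)_{i\in\mathcal{V}}$, with $\pi^{(k)}_0=\pi_0$, be the corresponding potentials, i.e. the potentials of the unique solution $(\phi^{(k)},\pi^{(k)})$ of $$\sum_{j\in\partial i}\phi^{(k)}_{ij}=q^{(k)}_i\ \ \forall i\in\mathcal{V},\qquad \pi^{(k)}_i-\pi^{(k)}_j=f_{ij}(\phi^{(k)}_{ij})-b_{ij}\ \ \forall(i,j)\in\mathcal{E}.$$ If $q^{(1)}_i\le q^{(2)}_i$ for all $i\in\mathcal{V}\setminus\{0\}$, then $\pi^{(1)}_i\le\pi^{(2)}_i$ for all $i\in\mathcal{V}\setminus\{0\}$.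
   Context: A dissipative flow network consists of a finite connected undirected simple graph $\mathcal{G}=(\mathcal{V},\mathcal{E})$ in which each edge has a fixed nominal orientation $i\to j$, written $(i,j)\in\mathcal{E}$ (each edge appears in $\mathcal{E}$ once). Each edge carries a flow $\phi_{ij}\in\mathbb{R}$ with the convention $\phi_{ji}=-\phi_{ij}$, and a real parameter $b_{ij}$; each node carries a potential $\pi_i\in\mathbb{R}$. $\partial i$ is the set of neighbours of $i$, so $\sum_{j\in\partial i}\phi_{ij}$ is the net outflow of node $i$. Each dissipation function $f_{ij}:\mathbb{R}\to\mathbb{R}$ is odd, differentiable, strictly increasing and invertible as a map $\mathbb{R}\to\mathbb{R}$ (a bijection of $\mathbb{R}$). Under these assumptions, for every balanced injection vector the displayed equations with $\pi_0$ fixed have a unique solution. *)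

theory Defs
  imports Complex_Main "Graph_Theory.Graph_Theory"
begin

text \<open>
  A finite connected simple graph with a nominal orientation is a finite loop-free digraph whose arc
  relation contains each edge in one direction only. The constant \<^const>\<open>Digraph_Component.connected\<close>
  ignores the orientation (it is connectedness of the symmetric closure) and excludes the empty graph.
  The qualifier distinguishes it from topological connectedness.
\<close>

locale dissipative_flow_network = pair_digraph G
  for G :: "'v pair_pre_digraph" +
  fixes f :: "'v \<Rightarrow> 'v \<Rightarrow> real \<Rightarrow> real"
  assumes one_orientation: "(i, j) \<in> parcs G \<Longrightarrow> (j, i) \<notin> parcs G"
    and connected_network: "Digraph_Component.connected (with_proj G)"
    and f_odd: "(i, j) \<in> parcs G \<Longrightarrow> f i j (- x) = - f i j x"
    and f_differentiable: "(i, j) \<in> parcs G \<Longrightarrow> f i j differentiable (at x)"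
    and f_strict_mono: "(i, j) \<in> parcs G \<Longrightarrow> strict_mono (f i j)"
    and f_bij: "(i, j) \<in> parcs G \<Longrightarrow> bij (f i j)"

definition neighbours :: "'v pair_pre_digraph \<Rightarrow> 'v \<Rightarrow> 'v set" where
  "neighbours G i = {j. (i, j) \<in> parcs G \<or> (j, i) \<in> parcs G}"

text \<open>The value of \<open>q\<close> at the reference node \<open>r\<close> is ignored and replaced by the one total balance dictates.\<close>

definition balanced_injection :: "'v pair_pre_digraph \<Rightarrow> 'v \<Rightarrow> ('v \<Rightarrow> real) \<Rightarrow> 'v \<Rightarrow> real" where
  "balanced_injection G r q i = (if i = r then - (\<Sum>k\<in>pverts G - {r}. q k) else q i)"

definition flow_solution ::
  "'v pair_pre_digraph \<Rightarrow> ('v \<Rightarrow> 'v \<Rightarrow> real \<Rightarrow> real) \<Rightarrow> ('v \<Rightarrow> 'v \<Rightarrow> real) \<Rightarrow> ('v \<Rightarrow> real)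
    \<Rightarrow> ('v \<Rightarrow> 'v \<Rightarrow> real) \<Rightarrow> ('v \<Rightarrow> real) \<Rightarrow> bool" where
  "flow_solution G f b q \<phi> \<pi> \<longleftrightarrow>
     (\<forall>(i, j)\<in>parcs G. \<phi> j i = - \<phi> i j) \<and>
     (\<forall>i\<in>pverts G. (\<Sum>j\<in>neighbours G i. \<phi> i j) = q i) \<and>
     (\<forall>(i, j)\<in>parcs G. \<pi> i - \<pi> j = f i j (\<phi> i j) - b i j)"

end

theory Submission
  imports Defs
begin

text \<open>
  The proof is a discrete maximum principle for the potential difference \<open>d = \<pi>1 - \<pi>2\<close>: it is
  largest at the reference node \<open>r\<close>, where it is zero (\<open>potential_difference_le_at_reference\<close>).
  Otherwise \<open>d\<close> would attain its maximum only at other nodes; let \<open>i\<close> be one of them. Towards each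
  neighbour of \<open>i\<close> the potential drop of the first solution is at least that of the second, and as
  dissipation functions are increasing, the same holds for the flows out of \<open>i\<close>
  (\<open>flow_le_iff_potential_drop_le\<close>). But the total flow out of \<open>i\<close> is the injection at \<open>i\<close>, which is
  at most as large in the first solution as in the second. So all these flows agree, hence so do the
  potential drops, and \<open>d\<close> is maximal at every neighbour of \<open>i\<close> as well
  (\<open>max_potential_difference_spreads\<close>). By connectedness the maximum spreads to \<open>r\<close>
  (\<open>vertex_property_spreads\<close>): a contradiction.
\<close>

context dissipative_flow_network
begin

lemma neighbours_subset_pverts: "neighbours G i \<subseteq> pverts G"
  unfolding neighbours_def using in_arcsD1 in_arcsD2 by blast

lemma finite_neighbours: "finite (neighbours G i)"
  using neighbours_subset_pverts pair_finite_verts by (rule finite_subset)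

lemma vertex_property_spreads:
  assumes "u \<in> pverts G" and "v \<in> pverts G" and "P u"
    and spreads: "\<And>i j. i \<in> pverts G \<Longrightarrow> P i \<Longrightarrow> j \<in> neighbours G i \<Longrightarrow> P j"
  shows "P v"
proof -
  let ?S = "mk_symmetric (with_proj G)"
  interpret S: pair_wf_digraph ?S ..
  have "reachable (with_proj ?S) u v"
    using connected_network assms(1,2)
    by (auto simp: Digraph_Component.connected_def strongly_connected_def)
  then have "v \<in> pverts G \<and> P v"
  proof (induction rule: S.reachable_induct)
    case base
    then show ?case using assms(1,3) by simp
  next
    case (step x y)
    then have "y \<in> neighbours G x"
      by (auto simp: neighbours_def parcs_mk_symmetric)
    with step.IH show ?case using neighbours_subset_pverts spreads by blast
  qed
  then show ?thesis ..
qed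

text \<open>
  Along an edge this is the strict monotonicity of its dissipation function, the common shift by \<open>b\<close>
  cancelling. Against the orientation, both the flows and the potential drops change sign, which
  reverses both inequalities.
\<close>

lemma flow_le_iff_potential_drop_le:
  assumes sol: "flow_solution G f b q \<phi> \<pi>" "flow_solution G f b q' \<phi>' \<pi>'"
    and "j \<in> neighbours G i"
  shows "\<phi> i j \<le> \<phi>' i j \<longleftrightarrow> \<pi> i - \<pi> j \<le> \<pi>' i - \<pi>' j"
proof -
  have drop: "\<pi> k - \<pi> l = f k l (\<phi> k l) - b k l" "\<pi>' k - \<pi>' l = f k l (\<phi>' k l) - b k l"
    and anti: "\<phi> l k = - \<phi> k l" "\<phi>' l k = - \<phi>' k l"
    and mono: "f k l x \<le> f k l y \<longleftrightarrow> x \<le> y"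
    if "(k, l) \<in> parcs G" for k l x y
    using sol that strict_mono_less_eq[OF f_strict_mono[OF that]]
    by (auto simp: flow_solution_def)
  consider "(i, j) \<in> parcs G" | "(j, i) \<in> parcs G"
    using assms(3) by (auto simp: neighbours_def)
  then show ?thesis
  proof cases
    case 1
    show ?thesis by (simp add: drop[OF 1] mono[OF 1])
  next
    case 2
    show ?thesis
      using drop[OF 2] mono[OF 2, of "\<phi>' j i" "\<phi> j i"] anti[OF 2] by linarith
  qed
qed

text \<open>
  Inequalities between the terms of two sums, opposed by the inequality between the sums, are
  equalities; this is the only place where the balance of flows at a node enters.
\<close>

lemma max_potential_difference_spreads:
  assumes sol: "flow_solution G f b q \<phi> \<pi>" "flow_solution G f b q' \<phi>' \<pi>'"
    and i: "i \<in> pverts G" and inj: "q i \<le> q' i"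
    and max: "\<And>j. j \<in> pverts G \<Longrightarrow> \<pi> j - \<pi>' j \<le> \<pi> i - \<pi>' i"
    and j: "j \<in> neighbours G i"
  shows "\<pi> j - \<pi>' j = \<pi> i - \<pi>' i"
proof -
  have ge: "\<phi>' i k \<le> \<phi> i k" if k: "k \<in> neighbours G i" for k
    using flow_le_iff_potential_drop_le[OF sol(2,1) k] max[of k] k neighbours_subset_pverts
    by force
  have "\<phi> i j = \<phi>' i j"
  proof (rule ccontr)
    assume "\<phi> i j \<noteq> \<phi>' i j"
    with ge[OF j] have "\<phi>' i j < \<phi> i j" by simp
    then have "(\<Sum>k\<in>neighbours G i. \<phi>' i k) < (\<Sum>k\<in>neighbours G i. \<phi> i k)"
      using ge j by (intro sum_strict_mono_ex1 finite_neighbours) auto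
    then show False using sol i inj by (simp add: flow_solution_def)
  qed
  then show ?thesis
    using flow_le_iff_potential_drop_le[OF sol j] flow_le_iff_potential_drop_le[OF sol(2,1) j]
    by linarith
qed

text \<open>
  The outflows of all nodes add up to zero, so larger injections elsewhere force a smaller one at
  \<open>r\<close>. There the maximum need not spread to the neighbours, which is why \<open>r\<close> is where it is found: if
  it were not attained at \<open>r\<close>, it would spread from every node that attains it.
\<close>

lemma potential_difference_le_at_reference:
  assumes sol: "flow_solution G f b q \<phi> \<pi>" "flow_solution G f b q' \<phi>' \<pi>'"
    and r: "r \<in> pverts G"
    and inj: "\<And>i. i \<in> pverts G - {r} \<Longrightarrow> q i \<le> q' i"
    and v: "v \<in> pverts G"
  shows "\<pi> v - \<pi>' v \<le> \<pi> r - \<pi>' r"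
proof -
  define d where "d i = \<pi> i - \<pi>' i" for i
  obtain u where u: "u \<in> pverts G" and max: "\<And>i. i \<in> pverts G \<Longrightarrow> d i \<le> d u"
    using Max_in[of "d ` pverts G"] Max_ge[of "d ` pverts G"] pair_finite_verts r by fastforce
  have "d r = d u"
  proof (rule ccontr)
    assume "d r \<noteq> d u"
    have "d j = d u" if "i \<in> pverts G" "d i = d u" "j \<in> neighbours G i" for i j
    proof -
      have "i \<noteq> r" using that(2) \<open>d r \<noteq> d u\<close> by auto
      then show ?thesis
        using max_potential_difference_spreads[OF sol that(1) _ _ that(3)] inj that(1,2) max
        by (simp add: d_def)
    qed
    then have "d r = d u"
      using vertex_property_spreads[OF u r, of "\<lambda>i. d i = d u"] by blast
    with \<open>d r \<noteq> d u\<close> show False ..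
  qed
  with max[OF v] show ?thesis by (simp add: d_def)
qed

end

theorem corollary1:
  fixes G :: "'v pair_pre_digraph"
    and f :: "'v \<Rightarrow> 'v \<Rightarrow> real \<Rightarrow> real"
    and b :: "'v \<Rightarrow> 'v \<Rightarrow> real"
    and r :: 'v
    and \<pi>\<^sub>0 :: real
    and q1 q2 :: "'v \<Rightarrow> real"
    and \<phi>1 \<phi>2 :: "'v \<Rightarrow> 'v \<Rightarrow> real"
    and \<pi>1 \<pi>2 :: "'v \<Rightarrow> real"
  assumes "dissipative_flow_network G f"
    and "r \<in> pverts G"
    and "flow_solution G f b (balanced_injection G r q1) \<phi>1 \<pi>1" and "\<pi>1 r = \<pi>\<^sub>0"
    and "flow_solution G f b (balanced_injection G r q2) \<phi>2 \<pi>2" and "\<pi>2 r = \<pi>\<^sub>0"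
    and "\<forall>i\<in>pverts G - {r}. q1 i \<le> q2 i"
  shows "\<forall>i\<in>pverts G - {r}. \<pi>1 i \<le> \<pi>2 i"
proof
  fix i
  assume i: "i \<in> pverts G - {r}"
  interpret dissipative_flow_network G f by fact
  have "\<pi>1 i - \<pi>2 i \<le> \<pi>1 r - \<pi>2 r"
    using assms(7) i
    by (intro potential_difference_le_at_reference[OF assms(3,5,2)])
      (auto simp: balanced_injection_def)
  then show "\<pi>1 i \<le> \<pi>2 i" using assms(4,6) by simp
qed

end
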